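(* Let $\mathbb{P}$ be generated by a PLSEM with DAG $D$ and edge functions $f_{j,i}$. Let $j$ be a child of $i$ in $D$ with $f_{j,i}$ nonlinear. If the functions in $\{f_{j',i}'':\ j'\text{ a child of }i\text{ in }D\text{ with }f_{j',i}\text{ nonlinear}\}$ are linearly independent, then $j$ is a descendant of $i$ in the DAG $D'$ of every PLSEM that generates $\mathbb{P}$.
   Context: A PLSEM with DAG $D$ on $\{1,\dots,p\}$ is a system $X_j=\mu_j+\sum_{i\in\mathrm{pa}_D(j)} f_{j,i}(X_i)+\varepsilon_j$, $j=1,\dots,p$, where $\mu_j\in\mathbb{R}$, $f_{j,i}\in C^2(\mathbb{R})$, $f_{j,i}\not\equiv 0$, $\mathbb{E}[f_{j,i}(X_i)]=0$, and $\varepsilon_1,\dots,\varepsilon_p$ are mutually independent with $\varepsilon_j\sim\mathcal{N}(0,\sigma_j^2)$, $\sigma_j^2>0$; the distribution of the solution $X$ is said to be generated by the PLSEM. A function $f_{j,i}$ is nonlinear if $f_{j,i}''\not\equiv 0$. A node $k$ is a descendant of $i$ if $k$ can be reached from $i$ along directed edges; every node is a descendant of itself. *)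

theory Defs
  imports "HOL-Probability.Probability"
begin

definition C2 :: "(real \<Rightarrow> real) \<Rightarrow> bool" where
  "C2 g \<longleftrightarrow> (\<forall>x. g differentiable at x) \<and> (\<forall>x. deriv g differentiable at x)
             \<and> continuous_on UNIV (deriv (deriv g))"

definition nonlinear :: "(real \<Rightarrow> real) \<Rightarrow> bool" where
  "nonlinear g \<longleftrightarrow> deriv (deriv g) \<noteq> (\<lambda>_. 0)"

text \<open>Parents of node j in DAG D (edges are pairs (i,j) meaning i \<rightarrow> j).\<close>
definition pa :: "(nat \<times> nat) set \<Rightarrow> nat \<Rightarrow> nat set" where
  "pa D j = {i. (i, j) \<in> D}"

definition ch :: "(nat \<times> nat) set \<Rightarrow> nat \<Rightarrow> nat set" where
  "ch D i = {j. (i, j) \<in> D}"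

definition plsem_struct :: "nat \<Rightarrow> (nat \<times> nat) set \<Rightarrow> (nat \<Rightarrow> nat \<Rightarrow> real \<Rightarrow> real) \<Rightarrow> bool" where
  "plsem_struct p D f \<longleftrightarrow> D \<subseteq> {1..p} \<times> {1..p} \<and> acyclic D \<and>
     (\<forall>(i, j) \<in> D. C2 (f j i) \<and> f j i \<noteq> (\<lambda>_. 0))"

definition generated_by ::
  "nat \<Rightarrow> (nat \<Rightarrow> real) measure \<Rightarrow> (nat \<times> nat) set \<Rightarrow> (nat \<Rightarrow> real)
     \<Rightarrow> (nat \<Rightarrow> nat \<Rightarrow> real \<Rightarrow> real) \<Rightarrow> (nat \<Rightarrow> real) \<Rightarrow> bool" where
  "generated_by p P D \<mu> f s2 \<longleftrightarrow>
     plsem_struct p D f \<and> (\<forall>j\<in>{1..p}. s2 j > 0) \<and>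
     (\<exists>(M :: (nat \<Rightarrow> real) measure) (\<epsilon> :: nat \<Rightarrow> (nat \<Rightarrow> real) \<Rightarrow> real) X.
        prob_space M \<and>
        prob_space.indep_vars M (\<lambda>_. borel) \<epsilon> {1..p} \<and>
        (\<forall>j\<in>{1..p}. distributed M lborel (\<epsilon> j) (normal_density 0 (sqrt (s2 j)))) \<and>
        (\<forall>j\<in>{1..p}. X j \<in> borel_measurable M) \<and>
        (\<forall>\<omega>\<in>space M. \<forall>j\<in>{1..p}.
           X j \<omega> = \<mu> j + (\<Sum>i\<in>pa D j. f j i (X i \<omega>)) + \<epsilon> j \<omega>) \<and>
        (\<forall>(i, j) \<in> D. integrable M (\<lambda>\<omega>. f j i (X i \<omega>)) \<and>
                         (\<integral>\<omega>. f j i (X i \<omega>) \<partial>M) = 0) \<and>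
        P = distr M (PiM {1..p} (\<lambda>_. borel)) (\<lambda>\<omega>. \<lambda>j\<in>{1..p}. X j \<omega>))"

end

theory Submission
  imports Defs
begin

text \<open>The density of X is, up to a constant, exp(-|F|^2/2), where F maps x to the standardised noise.
  Hence |F| = |F'| for the standardised noise maps of any two PLSEMs generating the same distribution.
  Both maps are sums of univariate vector functions and are triangular, which forces all inner products
  to agree as well: F' = O F with a constant orthogonal matrix O. Differentiating row k of
  F' = O F twice in the i-th coordinate, linear independence gives O(k,j) = 0 unless k is a child of i
  in D'. A unit change of the j-th noise of D shifts x(j) and leaves x(l) fixed for all parents l of j
  in D. In D' it only changes noise of children of i, so x(j) can move only if j is a descendant of i
  in D'.\<close>

section \<open>The noise map of a PLSEM and its inversion along the DAG\<close>

text \<open>The residuals are not standardised here; the variances enter later as weights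
  \<open>1 / s2 k\<close>. The arguments stay arbitrary, so that the same map with linear edge
  functions can describe coefficient systems in \<open>sum_noise_step_unit\<close>.\<close>

definition noise ::
  "(nat \<times> nat) set \<Rightarrow> (nat \<Rightarrow> real) \<Rightarrow> (nat \<Rightarrow> nat \<Rightarrow> real \<Rightarrow> real) \<Rightarrow> (nat \<Rightarrow> real) \<Rightarrow> nat \<Rightarrow> real"
  where "noise D \<mu> f x k = x k - \<mu> k - (\<Sum>l\<in>pa D k. f k l (x l))"

text \<open>Well-founded recursion along the edges: once the parents of \<open>k\<close> have
  values, the equation at \<open>k\<close> determines \<open>x k\<close>.\<close>

lemma noise_surj:
  assumes "wf D"
  obtains x where "\<And>k. noise D \<mu> f x k = z k"
proof -
  define R where "R = (\<lambda>g k. z k + \<mu> k + (\<Sum>l\<in>pa D k. f k l (g l)))"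
  define x where "x = wfrec D R"
  have "noise D \<mu> f x k = z k" for k
  proof -
    have "x k = R (cut x D k) k"
      unfolding x_def by (rule wfrec[OF assms])
    \<comment> \<open>\<open>R\<close> reads its argument only at parents of \<open>k\<close>, where
      \<open>cut\<close> changes nothing.\<close>
    also have "\<dots> = R x k"
      by (simp add: R_def pa_def cut_apply)
    finally have "x k = z k + \<mu> k + (\<Sum>l\<in>pa D k. f k l (x l))"
      unfolding R_def .
    then show ?thesis
      unfolding noise_def by linarith
  qed
  then show thesis using that by blast
qed

text \<open>A coordinate is a function of the noise at its ancestors, itself included. This local
  form of injectivity is what finally links noise to descendants.\<close>

lemma noise_eq_imp_eq:
  assumes "wf D" "\<And>a. (a, k) \<in> D\<^sup>* \<Longrightarrow> noise D \<mu> f x a = noise D \<mu> f y a"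
  shows "x k = y k"
  using assms(1,2)
proof (induction k rule: wf_induct_rule)
  case (less k)
  have "x l = y l" if "l \<in> pa D k" for l
  proof (rule less.IH)
    show "(l, k) \<in> D" using that by (simp add: pa_def)
    then show "noise D \<mu> f x a = noise D \<mu> f y a" if "(a, l) \<in> D\<^sup>*" for a
      using less.prems that by (meson rtrancl.rtrancl_into_rtrancl)
  qed
  then have "(\<Sum>l\<in>pa D k. f k l (x l)) = (\<Sum>l\<in>pa D k. f k l (y l))"
    by (intro sum.cong) auto
  with less.prems[of k] show ?case by (simp add: noise_def)
qed

lemma noise_cong:
  assumes "D \<subseteq> I \<times> I" "k \<in> I" "\<And>l. l \<in> I \<Longrightarrow> x l = y l"
  shows "noise D \<mu> f x k = noise D \<mu> f y k"
proof -
  have "pa D k \<subseteq> I" using assms(1) by (auto simp: pa_def)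
  then have "(\<Sum>l\<in>pa D k. f k l (x l)) = (\<Sum>l\<in>pa D k. f k l (y l))"
    using assms(3) by (intro sum.cong) auto
  then show ?thesis using assms by (simp add: noise_def)
qed

section \<open>Shears and the noise map preserve product Lebesgue measure\<close>

text \<open>A measurable inverse is carried along because it later maps the noise back to the
  solution \<open>X\<close>.\<close>

definition measure_automorphism :: "'a measure \<Rightarrow> ('a \<Rightarrow> 'a) \<Rightarrow> bool" where
  "measure_automorphism M T \<longleftrightarrow> T \<in> M \<rightarrow>\<^sub>M M \<and> distr M M T = M \<and>
     (\<exists>G \<in> M \<rightarrow>\<^sub>M M. \<forall>x\<in>space M. G (T x) = x \<and> T (G x) = x)"

lemma measure_automorphism_comp:
  assumes "measure_automorphism M S" "measure_automorphism M T"
  shows "measure_automorphism M (S \<circ> T)"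
proof -
  obtain G H where S: "S \<in> M \<rightarrow>\<^sub>M M" "distr M M S = M" and T: "T \<in> M \<rightarrow>\<^sub>M M" "distr M M T = M"
    and G: "G \<in> M \<rightarrow>\<^sub>M M" "\<forall>x\<in>space M. G (S x) = x \<and> S (G x) = x"
    and H: "H \<in> M \<rightarrow>\<^sub>M M" "\<forall>x\<in>space M. H (T x) = x \<and> T (H x) = x"
    using assms by (auto simp: measure_automorphism_def)
  have "S \<circ> T \<in> M \<rightarrow>\<^sub>M M" "H \<circ> G \<in> M \<rightarrow>\<^sub>M M"
    using S(1) T(1) G(1) H(1) by (auto intro: measurable_comp)
  moreover have "distr M M (S \<circ> T) = M"
    using distr_distr[OF S(1) T(1)] S(2) T(2) by simp
  moreover have "(H \<circ> G) ((S \<circ> T) x) = x \<and> (S \<circ> T) ((H \<circ> G) x) = x" if "x \<in> space M" for x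
    using that G H measurable_space[OF S(1)] measurable_space[OF T(1)] measurable_space[OF G(1)]
    by simp
  ultimately show ?thesis
    unfolding measure_automorphism_def by blast
qed

lemma measurable_shear:
  fixes h :: "(nat \<Rightarrow> real) \<Rightarrow> real"
  assumes k: "k \<in> I" and h: "h \<in> borel_measurable (PiM I (\<lambda>_. lborel))"
  shows "(\<lambda>x. x(k := x k + h x)) \<in> PiM I (\<lambda>_. lborel) \<rightarrow>\<^sub>M PiM I (\<lambda>_. lborel)"
proof -
  have "(\<lambda>x. x k) \<in> borel_measurable (PiM I (\<lambda>_. lborel :: real measure))"
    using measurable_component_singleton[OF k, of "\<lambda>_. lborel :: real measure"] by simp
  then have "(\<lambda>x. x k + h x) \<in> PiM I (\<lambda>_. lborel) \<rightarrow>\<^sub>M lborel"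
    using h by simp
  from measurable_fun_upd[OF _ measurable_ident this, of I] k show ?thesis
    by (simp add: insert_absorb id_def)
qed

interpretation lborel_product: product_sigma_finite "\<lambda>_::nat. lborel :: real measure"
  by standard

text \<open>By Tonelli, coordinate \<open>k\<close> is integrated innermost. With the other
  coordinates fixed, \<open>h x\<close> is a constant, so the shear acts as a translation of the
  real line.\<close>

lemma distr_shear:
  fixes h :: "(nat \<Rightarrow> real) \<Rightarrow> real"
  assumes fin: "finite I" and k: "k \<in> I"
    and h: "h \<in> borel_measurable (PiM I (\<lambda>_. lborel))" and indep: "\<And>x t. h (x(k := t)) = h x"
  shows "distr (PiM I (\<lambda>_. lborel)) (PiM I (\<lambda>_. lborel)) (\<lambda>x. x(k := x k + h x)) = PiM I (\<lambda>_. lborel)"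
    (is "distr ?L ?L ?T = ?L")
proof (rule measure_eqI)
  note T = measurable_shear[OF k h]
  fix A assume "A \<in> sets (distr ?L ?L ?T)"
  then have A: "A \<in> sets ?L" by simp
  define J where "J = I - {k}"
  have J: "finite J" "k \<notin> J" "insert k J = I" using fin k by (auto simp: J_def)
  note Fub = lborel_product.product_nn_integral_insert[OF J(1,2), unfolded J(3)]
  have ind: "(\<lambda>x. indicator A x :: ennreal) \<in> borel_measurable ?L"
    using A by simp
  have "emeasure (distr ?L ?L ?T) A = (\<integral>\<^sup>+x. indicator A x \<partial>distr ?L ?L ?T)"
    using A by simp
  also have "\<dots> = (\<integral>\<^sup>+x. indicator A (?T x) \<partial>?L)"
    by (rule nn_integral_distr[OF T]) (use ind in simp)
  also have "\<dots> = (\<integral>\<^sup>+x. (\<integral>\<^sup>+t. indicator A (x(k := t + h x)) \<partial>lborel) \<partial>PiM J (\<lambda>_. lborel))"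
    using Fub[OF measurable_compose[OF T ind]] by (simp add: indep)
  also have "\<dots> = (\<integral>\<^sup>+x. (\<integral>\<^sup>+t. indicator A (x(k := t)) \<partial>lborel) \<partial>PiM J (\<lambda>_. lborel))"
  proof (rule nn_integral_cong)
    fix x assume x: "x \<in> space (PiM J (\<lambda>_. lborel :: real measure))"
    have "(\<lambda>t. x(k := t)) \<in> lborel \<rightarrow>\<^sub>M ?L"
      using measurable_fun_upd[where J=J and I=I and M="\<lambda>_. lborel :: real measure" and N=lborel and i=k and f="\<lambda>_. x" and h="\<lambda>t. t"]
        x J by auto
    from measurable_compose[OF this ind]
    have "(\<lambda>t. indicator A (x(k := t)) :: ennreal) \<in> borel_measurable borel"
      by simp
    from nn_integral_real_affine[OF this, of 1 "h x"]
    show "(\<integral>\<^sup>+t. indicator A (x(k := t + h x)) \<partial>lborel) = (\<integral>\<^sup>+t. indicator A (x(k := t)) \<partial>lborel)"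
      by (simp add: add.commute)
  qed
  also have "\<dots> = emeasure ?L A"
    using Fub[OF ind] A by simp
  finally show "emeasure (distr ?L ?L ?T) A = emeasure ?L A" .
qed simp

text \<open>The shear with \<open>- h\<close> is the inverse, since \<open>h\<close> does not see
  the change in coordinate \<open>k\<close>.\<close>

lemma measure_automorphism_shear:
  fixes h :: "(nat \<Rightarrow> real) \<Rightarrow> real"
  assumes fin: "finite I" and k: "k \<in> I"
    and h: "h \<in> borel_measurable (PiM I (\<lambda>_. lborel))" and indep: "\<And>x t. h (x(k := t)) = h x"
  shows "measure_automorphism (PiM I (\<lambda>_. lborel)) (\<lambda>x. x(k := x k + h x))"
proof -
  have "(\<lambda>x. x(k := x k + - h x)) \<in> PiM I (\<lambda>_. lborel) \<rightarrow>\<^sub>M PiM I (\<lambda>_. lborel)"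
    using h by (intro measurable_shear k) simp
  moreover have "\<forall>x. (\<lambda>x. x(k := x k + - h x)) (x(k := x k + h x)) = x \<and>
      (\<lambda>x. x(k := x k + h x)) (x(k := x k + - h x)) = x"
    by (simp add: indep)
  ultimately show ?thesis
    unfolding measure_automorphism_def using measurable_shear[OF k h] distr_shear[OF assms]
    by (intro conjI bexI[of _ "\<lambda>x. x(k := x k + - h x)"]) simp_all
qed

text \<open>The noise map factors into shears when the nodes are processed against the direction of the
  edges: the coordinates that a shear reads have then not been overwritten.\<close>

lemma measure_automorphism_noise:
  assumes fin: "finite I" and D: "D \<subseteq> I \<times> I" "wf D"
    and f: "\<And>k l. (l, k) \<in> D \<Longrightarrow> f k l \<in> borel_measurable borel"
  shows "measure_automorphism (PiM I (\<lambda>_. lborel)) (\<lambda>x. \<lambda>k\<in>I. noise D \<mu> f x k)"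
proof -
  let ?L = "PiM I (\<lambda>_. lborel :: real measure)"
  \<comment> \<open>\<open>E K\<close> replaces only the coordinates in \<open>K\<close> by their
    noise. The induction runs over the sets \<open>K\<close> closed under taking children, from the
    empty set up to \<open>I\<close>.\<close>
  define E where "E = (\<lambda>K x. \<lambda>k\<in>I. if k \<in> K then noise D \<mu> f x k else x k)"
  have "measure_automorphism ?L (E K)"
    if "finite K" "K \<subseteq> I" "\<And>l k. (l, k) \<in> D \<Longrightarrow> l \<in> K \<Longrightarrow> k \<in> K" for K
    using that
  proof (induction K rule: finite_psubset_induct)
    case (psubset K)
    show ?case
    proof (cases "K = {}")
      case True
      \<comment> \<open>\<open>E {}\<close> is restriction to \<open>I\<close>, hence the identity
        on the extensional functions only.\<close>
      have *: "E {} x = x" if "x \<in> space ?L" for x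
        using that by (auto simp: E_def space_PiM PiE_def extensional_def)
      then have "E {} \<in> ?L \<rightarrow>\<^sub>M ?L" "distr ?L ?L (E {}) = ?L"
        using measurable_cong[of ?L "E {}" "\<lambda>x. x" ?L] distr_cong[of ?L ?L ?L ?L "E {}" "\<lambda>x. x"]
        by (auto simp: distr_id)
      then show ?thesis
        using * True unfolding measure_automorphism_def
        by (auto intro!: bexI[of _ "\<lambda>x. x"])
    next
      case False
      \<comment> \<open>As no parent of \<open>k\<close> lies in \<open>K\<close>, the set
        \<open>K - {k}\<close> is still closed under children, and \<open>E (K - {k})\<close> leaves
        the parents of \<open>k\<close> untouched.\<close>
      then obtain k where k: "k \<in> K" and min: "\<And>l. (l, k) \<in> D \<Longrightarrow> l \<notin> K"
        using wfE_min[OF D(2)] by (metis ex_in_conv)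
      define h where "h = (\<lambda>x. - (\<mu> k + (\<Sum>l\<in>pa D k. f k l (x l))))"
      have kI: "k \<in> I" using k psubset.prems by auto
      have comp: "(\<lambda>x. f k l (x l)) \<in> borel_measurable ?L" if "l \<in> pa D k" for l
      proof -
        have "(\<lambda>x. x l) \<in> ?L \<rightarrow>\<^sub>M lborel"
          using that D by (intro measurable_component_singleton) (auto simp: pa_def)
        then have "(\<lambda>x. x l) \<in> ?L \<rightarrow>\<^sub>M borel" by simp
        from measurable_compose[OF this f] that show ?thesis by (simp add: pa_def)
      qed
      have "h \<in> borel_measurable ?L"
        unfolding h_def using comp by simp
      moreover have "h (x(k := t)) = h x" for x t
        using min k by (auto simp: h_def pa_def intro!: sum.cong)
      ultimately have "measure_automorphism ?L (\<lambda>x. x(k := x k + h x))"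
        by (intro measure_automorphism_shear fin kI)
      moreover have "measure_automorphism ?L (E (K - {k}))"
        using k min psubset.prems by (intro psubset.IH) auto
      moreover have "E K = (\<lambda>x. x(k := x k + h x)) \<circ> E (K - {k})"
      proof (intro ext)
        fix x a
        have "h (E (K - {k}) x) = - (\<mu> k + (\<Sum>l\<in>pa D k. f k l (x l)))"
          unfolding h_def using min D by (auto simp: E_def pa_def intro!: arg_cong[where f=uminus] sum.cong)
        then show "E K x a = ((\<lambda>x. x(k := x k + h x)) \<circ> E (K - {k})) x a"
          using k kI by (auto simp: E_def noise_def)
      qed
      ultimately show ?thesis by (simp only: measure_automorphism_comp)
    qed
  qed
  from this[of I] have "measure_automorphism ?L (E I)"
    using fin D by blast
  moreover have "E I = (\<lambda>x. \<lambda>k\<in>I. noise D \<mu> f x k)"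
    by (simp add: E_def fun_eq_iff)
  ultimately show ?thesis by simp
qed

section \<open>Lebesgue density of the generated distribution\<close>

lemma C2_continuous: "C2 g \<Longrightarrow> continuous_on UNIV g"
  unfolding C2_def
  by (metis differentiable_at_imp_differentiable_on differentiable_imp_continuous_on)

text \<open>A product measure is determined by its values on boxes, and there the integral of the
  product density factorises.\<close>

lemma PiM_density:
  fixes g :: "nat \<Rightarrow> real \<Rightarrow> ennreal"
  assumes fin: "finite I" and g: "\<And>i. i \<in> I \<Longrightarrow> g i \<in> borel_measurable borel"
    and prob: "\<And>i. i \<in> I \<Longrightarrow> prob_space (density lborel (g i))"
  shows "PiM I (\<lambda>i. density lborel (g i)) = density (PiM I (\<lambda>_. lborel)) (\<lambda>x. \<Prod>i\<in>I. g i (x i))"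
proof -
  let ?L = "PiM I (\<lambda>_. lborel :: real measure)"
  \<comment> \<open>Outside \<open>I\<close> nothing is known about \<open>g\<close>, but
    \<open>product_sigma_finite\<close> asks for sigma-finiteness at every index;
    \<open>lborel\<close> serves as default.\<close>
  define M where "M = (\<lambda>i. if i \<in> I then density lborel (g i) else lborel)"
  interpret M: product_sigma_finite M
  proof (rule product_sigma_finite.intro)
    show "sigma_finite_measure (M i)" for i
      by (cases "i \<in> I") (simp_all add: M_def prob prob_space_imp_sigma_finite lborel.sigma_finite_measure_axioms)
  qed
  have comp: "(\<lambda>x. x i) \<in> borel_measurable ?L" if "i \<in> I" for i
    using measurable_component_singleton[OF that, of "\<lambda>_. lborel :: real measure"] by simp
  have meas: "(\<lambda>x. \<Prod>i\<in>I. g i (x i)) \<in> borel_measurable ?L"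
    using comp g by (intro borel_measurable_prod_ennreal) (auto intro: measurable_compose)
  have "density ?L (\<lambda>x. \<Prod>i\<in>I. g i (x i)) = PiM I M"
  proof (rule M.PiM_eqI[OF fin])
    show "sets (density ?L (\<lambda>x. \<Prod>i\<in>I. g i (x i))) = sets (PiM I M)"
      by (auto simp: M_def intro!: sets_PiM_cong)
    fix A assume "\<And>i. i \<in> I \<Longrightarrow> A i \<in> sets (M i)"
    then have A: "A i \<in> sets borel" if "i \<in> I" for i using that by (auto simp: M_def)
    have "emeasure (density ?L (\<lambda>x. \<Prod>i\<in>I. g i (x i))) (Pi\<^sub>E I A) =
        (\<integral>\<^sup>+x. (\<Prod>i\<in>I. g i (x i)) * indicator (Pi\<^sub>E I A) x \<partial>?L)"
      using A fin by (intro emeasure_density meas sets_PiM_I_finite) auto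
    also have "\<dots> = (\<integral>\<^sup>+x. (\<Prod>i\<in>I. g i (x i) * indicator (A i) (x i)) \<partial>?L)"
    proof (rule nn_integral_cong)
      fix x assume "x \<in> space ?L"
      then have "indicator (Pi\<^sub>E I A) x = (\<Prod>i\<in>I. indicator (A i) (x i) :: ennreal)"
        using fin by (auto simp: indicator_def space_PiM PiE_iff intro!: prod.neutral[symmetric] prod_zero[symmetric])
      then show "(\<Prod>i\<in>I. g i (x i)) * indicator (Pi\<^sub>E I A) x = (\<Prod>i\<in>I. g i (x i) * indicator (A i) (x i))"
        by (simp add: prod.distrib)
    qed
    also have "\<dots> = (\<Prod>i\<in>I. \<integral>\<^sup>+t. g i t * indicator (A i) t \<partial>lborel)"
      using A g fin by (intro lborel_product.product_nn_integral_prod) auto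
    also have "\<dots> = (\<Prod>i\<in>I. emeasure (M i) (A i))"
      using A g by (intro prod.cong refl) (simp add: M_def emeasure_density)
    finally show "emeasure (density ?L (\<lambda>x. \<Prod>i\<in>I. g i (x i))) (Pi\<^sub>E I A) = (\<Prod>i\<in>I. emeasure (M i) (A i))" .
  qed
  also have "PiM I M = PiM I (\<lambda>i. density lborel (g i))"
    by (intro PiM_cong) (auto simp: M_def)
  finally show ?thesis by simp
qed

lemma plsem_struct_wf:
  assumes "plsem_struct p D f"
  shows "wf D"
proof -
  have "D \<subseteq> {1..p} \<times> {1..p}" "acyclic D"
    using assms by (simp_all add: plsem_struct_def)
  then show ?thesis
    by (intro finite_acyclic_wf) (auto intro: finite_subset)
qed

text \<open>Independence gives the noise vector a product of normal densities. The solution is its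
  image under the inverse of the noise map, which preserves Lebesgue measure, so no Jacobian factor
  appears. The bound \<open>1 \<le> p\<close> provides the nonempty index set for the product
  characterisation of independence.\<close>

lemma generated_by_density:
  assumes gen: "generated_by p P D \<mu> f s2" and p: "1 \<le> p"
  shows "P = density (PiM {1..p} (\<lambda>_. lborel))
    (\<lambda>x. ennreal (\<Prod>k=1..p. normal_density 0 (sqrt (s2 k)) (noise D \<mu> f x k)))"
proof -
  let ?I = "{1..p}"
  let ?L = "PiM ?I (\<lambda>_. lborel :: real measure)"
  let ?B = "PiM ?I (\<lambda>_. borel :: real measure)"
  let ?g = "\<lambda>k. normal_density 0 (sqrt (s2 k))"
  let ?E = "\<lambda>x. \<lambda>k\<in>?I. noise D \<mu> f x k"
  obtain M :: "(nat \<Rightarrow> real) measure" and \<epsilon> :: "nat \<Rightarrow> (nat \<Rightarrow> real) \<Rightarrow> real" and X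
    where str: "plsem_struct p D f" and s2: "\<And>k. k \<in> ?I \<Longrightarrow> s2 k > 0"
    and M: "prob_space M" and ind: "prob_space.indep_vars M (\<lambda>_. borel) \<epsilon> ?I"
    and dist: "\<And>k. k \<in> ?I \<Longrightarrow> distributed M lborel (\<epsilon> k) (?g k)"
    and X: "\<And>k. k \<in> ?I \<Longrightarrow> X k \<in> borel_measurable M"
    and eq: "\<And>\<omega> k. \<omega> \<in> space M \<Longrightarrow> k \<in> ?I \<Longrightarrow>
       X k \<omega> = \<mu> k + (\<Sum>l\<in>pa D k. f k l (X l \<omega>)) + \<epsilon> k \<omega>"
    and P: "P = distr M ?B (\<lambda>\<omega>. \<lambda>k\<in>?I. X k \<omega>)"
    using gen unfolding generated_by_def by blast
  interpret prob_space M by fact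
  \<comment> \<open>\<open>P\<close> is defined over the product of \<open>borel\<close>, the
    density over the product of \<open>lborel\<close>. Measurability is transported between them
    through this equality of sets.\<close>
  have LB: "sets ?L = sets ?B" by (intro sets_PiM_cong) auto
  have wf: "wf D" and D: "D \<subseteq> ?I \<times> ?I" using str plsem_struct_wf by (auto simp: plsem_struct_def)
  have fmeas: "f k l \<in> borel_measurable borel" if "(l, k) \<in> D" for k l
    using str that by (intro borel_measurable_continuous_onI C2_continuous) (auto simp: plsem_struct_def)
  have "measure_automorphism ?L ?E"
    by (rule measure_automorphism_noise[OF _ D wf fmeas]) auto
  then obtain G where E: "?E \<in> ?L \<rightarrow>\<^sub>M ?L" "distr ?L ?L ?E = ?L"
    and G: "G \<in> ?L \<rightarrow>\<^sub>M ?L" and GE: "\<And>x. x \<in> space ?L \<Longrightarrow> G (?E x) = x"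
    unfolding measure_automorphism_def by blast
  have rv: "random_variable borel (\<epsilon> k)" if "k \<in> ?I" for k
    using dist[OF that] by (simp add: distributed_def)
  define N where "N = density ?L (\<lambda>z. \<Prod>k\<in>?I. ennreal (?g k (z k)))"
  have "distr M ?B (\<lambda>\<omega>. \<lambda>k\<in>?I. \<epsilon> k \<omega>) = PiM ?I (\<lambda>k. distr M borel (\<epsilon> k))"
    using ind rv p by (subst indep_vars_iff_distr_eq_PiM'[symmetric]) auto
  also have "\<dots> = PiM ?I (\<lambda>k. density lborel (?g k))"
  proof (rule PiM_cong)
    fix k assume "k \<in> ?I"
    then show "distr M borel (\<epsilon> k) = density lborel (?g k)"
      using dist[of k] by (auto simp: distributed_def cong: distr_cong)
  qed simp
  also have "\<dots> = N"
    unfolding N_def using s2 by (intro PiM_density) (auto intro: prob_space_normal_density)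
  finally have N: "distr M ?B (\<lambda>\<omega>. \<lambda>k\<in>?I. \<epsilon> k \<omega>) = N" .
  have XL: "(\<lambda>\<omega>. \<lambda>k\<in>?I. X k \<omega>) \<in> M \<rightarrow>\<^sub>M ?B" "(\<lambda>\<omega>. \<lambda>k\<in>?I. \<epsilon> k \<omega>) \<in> M \<rightarrow>\<^sub>M ?B"
    using X rv by (auto intro!: measurable_restrict)
  have GB: "G \<in> ?B \<rightarrow>\<^sub>M ?B" using G measurable_cong_sets[OF LB LB] by simp
  have "(\<lambda>k\<in>?I. X k \<omega>) = G (\<lambda>k\<in>?I. \<epsilon> k \<omega>)" if "\<omega> \<in> space M" for \<omega>
  proof -
    have "noise D \<mu> f (\<lambda>k\<in>?I. X k \<omega>) k = \<epsilon> k \<omega>" if "k \<in> ?I" for k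
    proof -
      have "noise D \<mu> f (\<lambda>k\<in>?I. X k \<omega>) k = noise D \<mu> f (\<lambda>k. X k \<omega>) k"
        using that by (intro noise_cong[OF D]) auto
      also have "\<dots> = \<epsilon> k \<omega>" using eq[OF \<open>\<omega> \<in> space M\<close> that] by (simp add: noise_def)
      finally show ?thesis .
    qed
    then have "?E (\<lambda>k\<in>?I. X k \<omega>) = (\<lambda>k\<in>?I. \<epsilon> k \<omega>)" by (intro restrict_ext) auto
    moreover have "(\<lambda>k\<in>?I. X k \<omega>) \<in> space ?L" by (simp add: space_PiM)
    ultimately show ?thesis using GE by metis
  qed
  then have "P = distr M ?B (\<lambda>\<omega>. G (\<lambda>k\<in>?I. \<epsilon> k \<omega>))"
    unfolding P by (intro distr_cong) auto
  also have "\<dots> = distr N ?B G"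
    unfolding N[symmetric] using distr_distr[OF GB XL(2)] by (simp add: comp_def)
  also have "\<dots> = density ?L (\<lambda>x. \<Prod>k\<in>?I. ennreal (?g k (noise D \<mu> f x k)))" (is "_ = density ?L ?h")
  proof (rule measure_eqI)
    show "sets (distr N ?B G) = sets (density ?L ?h)" by (simp only: LB sets_distr sets_density)
    fix A assume "A \<in> sets (distr N ?B G)"
    then have A: "A \<in> sets ?L" by (simp only: LB sets_distr)
    define \<Phi> where "\<Phi> = (\<lambda>z::nat \<Rightarrow> real. \<Prod>k\<in>?I. ennreal (?g k (z k)))"
    have comp: "(\<lambda>x. x k) \<in> borel_measurable ?L" if "k \<in> ?I" for k
      using measurable_component_singleton[OF that, of "\<lambda>_. lborel :: real measure"] by simp
    have \<Phi>: "\<Phi> \<in> borel_measurable ?L" unfolding \<Phi>_def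
    proof (rule borel_measurable_prod_ennreal)
      fix k assume "k \<in> ?I"
      show "(\<lambda>z. ennreal (?g k (z k))) \<in> borel_measurable ?L"
        using measurable_compose[OF comp[OF \<open>k \<in> ?I\<close>] borel_measurable_normal_density]
        by simp
    qed
    have \<Phi>E: "\<Phi> (?E x) = ?h x" for x by (auto simp: \<Phi>_def intro!: prod.cong)
    have meas: "(\<lambda>z. \<Phi> z * indicator A (G z)) \<in> borel_measurable ?L"
      using \<Phi> measurable_compose[OF G borel_measurable_indicator[OF A]] by (rule borel_measurable_times_ennreal)
    have h: "?h \<in> borel_measurable ?L"
      using measurable_compose[OF E(1) \<Phi>] by (simp only: \<Phi>E)
    have GN: "G \<in> N \<rightarrow>\<^sub>M ?B"
      using GB measurable_cong_sets[of N ?B ?B ?B] by (simp add: N_def LB del: One_nat_def)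
    have "emeasure (distr N ?B G) A = emeasure N (G -` A \<inter> space ?L)"
      using GN A by (subst emeasure_distr) (simp_all only: LB N_def space_density)
    also have "\<dots> = (\<integral>\<^sup>+z. \<Phi> z * indicator (G -` A \<inter> space ?L) z \<partial>?L)"
      unfolding N_def \<Phi>_def[symmetric] using measurable_sets[OF G A] \<Phi> by (simp add: emeasure_density)
    also have "\<dots> = (\<integral>\<^sup>+z. \<Phi> z * indicator A (G z) \<partial>?L)"
      by (intro nn_integral_cong) (auto simp: indicator_def)
    \<comment> \<open>Change of variables \<open>z = ?E x\<close>, justified by the invariance of
      \<open>?L\<close> under \<open>?E\<close>; afterwards \<open>G\<close> cancels against
      \<open>?E\<close>.\<close>
    also have "\<dots> = (\<integral>\<^sup>+z. \<Phi> z * indicator A (G z) \<partial>distr ?L ?L ?E)"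
      by (simp only: E(2))
    also have "\<dots> = (\<integral>\<^sup>+x. \<Phi> (?E x) * indicator A (G (?E x)) \<partial>?L)"
      by (rule nn_integral_distr[OF E(1)]) (simp only: measurable_distr_eq1 meas)
    also have "\<dots> = (\<integral>\<^sup>+x. ?h x * indicator A x \<partial>?L)"
      by (intro nn_integral_cong) (simp only: \<Phi>E GE)
    also have "\<dots> = emeasure (density ?L ?h) A"
      using h A by (simp add: emeasure_density)
    finally show "emeasure (distr N ?B G) A = emeasure (density ?L ?h) A" .
  qed
  also have "?h = (\<lambda>x. ennreal (\<Prod>k\<in>?I. ?g k (noise D \<mu> f x k)))"
    by (auto simp: prod_ennreal)
  finally show ?thesis .
qed

section \<open>The quadratic form in the noise is determined by the distribution\<close>

text \<open>If \<open>h\<close> and \<open>h'\<close> differed at \<open>a\<close>, they would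
  differ on an open box around \<open>a\<close>. The box would be a null set, so one of its sides
  would be null, which is impossible for a nonempty open set of reals.\<close>

lemma AE_eq_imp_eq_of_continuous:
  fixes h h' :: "(nat \<Rightarrow> real) \<Rightarrow> real"
  assumes fin: "finite I" and cont: "continuous_on UNIV h" "continuous_on UNIV h'"
    and AE: "AE x in PiM I (\<lambda>_. lborel). h x = h' x" and a: "a \<in> extensional I"
  shows "h a = h' a"
proof (rule ccontr)
  let ?L = "PiM I (\<lambda>_. lborel :: real measure)"
  assume neq: "h a \<noteq> h' a"
  have "open {x. h x - h' x \<noteq> 0}"
    using cont by (intro open_Collect_neq continuous_intros)
  then have "openin (product_topology (\<lambda>_::nat. euclidean) UNIV) {x. h x - h' x \<noteq> 0}"
    by (simp add: open_fun_def)
  from product_topology_open_contains_basis[OF this, of a] neq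
  obtain U where U: "a \<in> (\<Pi>\<^sub>E k\<in>UNIV. U k)" "\<And>k. open (U k :: real set)"
    and sub: "(\<Pi>\<^sub>E k\<in>UNIV. U k) \<subseteq> {x. h x - h' x \<noteq> 0}"
    by auto
  have "AE x in ?L. x \<notin> Pi\<^sub>E I U"
    using AE
  proof eventually_elim
    case (elim x)
    have "x \<in> (\<Pi>\<^sub>E k\<in>UNIV. U k)" if x: "x \<in> Pi\<^sub>E I U"
    proof -
      \<comment> \<open>Outside \<open>I\<close> both \<open>x\<close> and \<open>a\<close> take the
        value \<open>undefined\<close>, so \<open>x\<close> inherits membership from
        \<open>a\<close>.\<close>
      have "x k \<in> U k" for k
        using x U(1) a by (cases "k \<in> I") (auto simp: PiE_iff extensional_def dest!: spec[of _ k])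
      then show ?thesis by auto
    qed
    then show ?case using sub elim by auto
  qed
  moreover have "Pi\<^sub>E I U \<in> sets ?L"
    using U(2) fin by (intro sets_PiM_I_finite) auto
  ultimately have "emeasure ?L (Pi\<^sub>E I U) = 0"
    by (subst (asm) AE_iff_measurable[OF _ refl]) (auto simp: sets.sets_into_space Int_absorb1 
        dest: sets.sets_into_space simp flip: Int_def)
  moreover have "emeasure ?L (Pi\<^sub>E I U) = (\<Prod>k\<in>I. emeasure lborel (U k))"
    using U(2) fin by (intro lborel_product.emeasure_PiM) auto
  ultimately obtain k where "emeasure lborel (U k) = 0"
    using fin by (auto simp: prod_zero_iff)
  then have "U k \<in> null_sets lebesgue"
    using U(2) by (intro null_sets_completionI) auto
  then have "negligible (U k)" by (simp add: negligible_iff_null_sets)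
  with open_not_negligible[OF U(2)] U(1) show False by auto
qed

lemma noise_continuous:
  assumes "plsem_struct p D f"
  shows "continuous_on UNIV (\<lambda>x. noise D \<mu> f x k)"
proof -
  have comp: "continuous_on UNIV (\<lambda>x::nat \<Rightarrow> real. x l)" for l
    by (rule continuous_on_product_coordinates)
  have "continuous_on UNIV (\<lambda>x. f k l (x l))" if "l \<in> pa D k" for l
  proof (rule continuous_on_compose2[OF C2_continuous comp])
    show "C2 (f k l)" using assms that by (auto simp: plsem_struct_def pa_def)
  qed simp
  then show ?thesis
    unfolding noise_def by (intro continuous_intros comp)
qed

text \<open>By continuity the two densities agree everywhere. Each has the form
  \<open>c * exp (- S / 2)\<close> with \<open>S\<close> nonnegative and zero somewhere, so
  \<open>c\<close> is the maximum of the density. Hence the constants coincide, and then so do the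
  exponents.\<close>

lemma generated_by_quadratic_form_unique:
  assumes gen: "generated_by p P D \<mu> f s2" and gen': "generated_by p P D' \<mu>' f' s2'" and p: "1 \<le> p"
  shows "(\<Sum>k=1..p. (noise D \<mu> f x k)\<^sup>2 / s2 k) = (\<Sum>k=1..p. (noise D' \<mu>' f' x k)\<^sup>2 / s2' k)"
proof -
  define h where "h = (\<lambda>D \<mu> f s2 x. \<Prod>k=1..p. normal_density 0 (sqrt (s2 k)) (noise D \<mu> f x k))"
  define c where "c = (\<lambda>s2::nat \<Rightarrow> real. \<Prod>k=1..p. 1 / sqrt (2 * pi * s2 k))"
  define S where "S = (\<lambda>D \<mu> f s2 x. \<Sum>k=1..p. (noise D \<mu> f x k)\<^sup>2 / s2 k)"
  have facts: "plsem_struct p D f" "\<And>k. k \<in> {1..p} \<Longrightarrow> s2 k > 0" "wf D" "D \<subseteq> {1..p} \<times> {1..p}"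
    if "generated_by p P D \<mu> f s2" for D \<mu> f s2
    using that plsem_struct_wf by (auto simp: generated_by_def plsem_struct_def)
  have h_eq: "h D \<mu> f s2 x = c s2 * exp (- S D \<mu> f s2 x / 2)"
    and c_pos: "c s2 > 0" and S_nonneg: "S D \<mu> f s2 x \<ge> 0"
    if "generated_by p P D \<mu> f s2" for D \<mu> f s2 x
  proof -
    note pos = facts(2)[OF that]
    have "h D \<mu> f s2 x = (\<Prod>k=1..p. 1 / sqrt (2 * pi * s2 k) * exp (- ((noise D \<mu> f x k)\<^sup>2 / s2 k / 2)))"
      unfolding h_def using pos by (intro prod.cong) (auto simp: normal_density_def real_sqrt_pow2 less_imp_le field_simps)
    also have "\<dots> = c s2 * exp (\<Sum>k=1..p. - ((noise D \<mu> f x k)\<^sup>2 / s2 k / 2))"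
      unfolding c_def by (subst exp_sum) (simp_all only: prod.distrib finite_atLeastAtMost)
    also have "(\<Sum>k=1..p. - ((noise D \<mu> f x k)\<^sup>2 / s2 k / 2)) = - S D \<mu> f s2 x / 2"
      by (simp add: S_def sum_negf sum_divide_distrib)
    finally show "h D \<mu> f s2 x = c s2 * exp (- S D \<mu> f s2 x / 2)" .
    show "c s2 > 0" unfolding c_def using pos by (intro prod_pos) auto
    show "S D \<mu> f s2 x \<ge> 0" unfolding S_def using pos by (intro sum_nonneg) (auto simp: less_imp_le)
  qed
  have cont: "continuous_on UNIV (h D \<mu> f s2)" if "generated_by p P D \<mu> f s2" for D \<mu> f s2
    unfolding h_eq[OF that] S_def using facts(2)[OF that]
    by (intro continuous_intros noise_continuous[OF facts(1)[OF that]] ballI less_imp_neq[symmetric]) simp_all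
  have bm: "(\<lambda>x. ennreal (h D \<mu> f s2 x)) \<in> borel_measurable (PiM {1..p} (\<lambda>_. lborel))"
    if "generated_by p P D \<mu> f s2" for D \<mu> f s2
  proof -
    have comp: "(\<lambda>x. x k) \<in> borel_measurable (PiM {1..p} (\<lambda>_. lborel :: real measure))" if "k \<in> {1..p}" for k
      using measurable_component_singleton[OF that, of "\<lambda>_. lborel :: real measure"] by simp
    have "(\<lambda>x. f k l (x l)) \<in> borel_measurable (PiM {1..p} (\<lambda>_. lborel))" if "l \<in> pa D k" for k l
    proof -
      have "(l, k) \<in> D" "l \<in> {1..p}"
        using facts(4)[OF \<open>generated_by p P D \<mu> f s2\<close>] that by (auto simp: pa_def)
      then have "f k l \<in> borel_measurable borel"
        using facts(1)[OF \<open>generated_by p P D \<mu> f s2\<close>]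
        by (intro borel_measurable_continuous_onI C2_continuous) (auto simp: plsem_struct_def)
      from measurable_compose[OF comp[OF \<open>l \<in> {1..p}\<close>] this] show ?thesis .
    qed
    then have "(\<lambda>x. noise D \<mu> f x k) \<in> borel_measurable (PiM {1..p} (\<lambda>_. lborel))" if "k \<in> {1..p}" for k
      unfolding noise_def using comp[OF that] by (intro borel_measurable_diff borel_measurable_sum) auto
    from measurable_compose[OF this borel_measurable_normal_density]
    have "h D \<mu> f s2 \<in> borel_measurable (PiM {1..p} (\<lambda>_. lborel))"
      unfolding h_def by (intro borel_measurable_prod) auto
    then show ?thesis by simp
  qed
  interpret finite_product_sigma_finite "\<lambda>_. lborel :: real measure" "{1..p}"
    by standard auto
  have "density (PiM {1..p} (\<lambda>_. lborel)) (\<lambda>x. ennreal (h D \<mu> f s2 x)) =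
      density (PiM {1..p} (\<lambda>_. lborel)) (\<lambda>x. ennreal (h D' \<mu>' f' s2' x))"
    unfolding h_def using generated_by_density[OF gen p] generated_by_density[OF gen' p] by simp
  from density_unique[OF bm[OF gen] bm[OF gen'] this]
  have "AE x in PiM {1..p} (\<lambda>_. lborel). h D \<mu> f s2 x = h D' \<mu>' f' s2' x"
    by eventually_elim (simp add: h_def prod_nonneg)
  then have "h D \<mu> f s2 x = h D' \<mu>' f' s2' x" if "x \<in> extensional {1..p}" for x
    using AE_eq_imp_eq_of_continuous[OF _ cont[OF gen] cont[OF gen'] _ that] by simp
  \<comment> \<open>The noise at nodes of the graph reads only coordinates of nodes, so equality on
    extensional functions extends to all \<open>x\<close>.\<close>
  moreover have "h D \<mu> f s2 x = h D \<mu> f s2 (restrict x {1..p})" if "generated_by p P D \<mu> f s2" for D \<mu> f s2 x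
  proof -
    have "noise D \<mu> f x k = noise D \<mu> f (restrict x {1..p}) k" if "k \<in> {1..p}" for k
      using facts(4)[OF \<open>generated_by p P D \<mu> f s2\<close>] that by (intro noise_cong) auto
    then show ?thesis by (simp add: h_def)
  qed
  ultimately have eq: "h D \<mu> f s2 x = h D' \<mu>' f' s2' x" for x
    using gen gen' by (metis restrict_extensional)
  \<comment> \<open>One density is evaluated where its own noise vanishes, the other is bounded by
    its constant. The claim is stated generally because it is used in both directions.\<close>
  have le: "c s2 \<le> c s2'" if "generated_by p P D \<mu> f s2" "generated_by p P D' \<mu>' f' s2'"
    and eq: "\<And>x. h D \<mu> f s2 x = h D' \<mu>' f' s2' x" for D \<mu> f s2 D' \<mu>' f' s2'
  proof -
    have "wf D" using facts(3) that(1) .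
    from noise_surj[OF this, of \<mu> f "\<lambda>_. 0"] obtain x where "\<And>k. noise D \<mu> f x k = 0" by blast
    then have "c s2 = h D \<mu> f s2 x" by (simp add: h_eq[OF that(1)] S_def)
    also have "\<dots> \<le> c s2' * 1"
      unfolding eq h_eq[OF that(2)] using c_pos[OF that(2)] S_nonneg[OF that(2)]
      by (intro mult_left_mono) auto
    finally show ?thesis by simp
  qed
  have "c s2 = c s2'" using le[OF gen gen' eq] le[OF gen' gen eq[symmetric]] by simp
  then show ?thesis
    using eq[of x] c_pos[OF gen'] by (simp add: h_eq[OF gen] h_eq[OF gen'] S_def)
qed

section \<open>Inner products of additive maps with equal norms\<close>

lemma sum_eq_two:
  fixes g :: "'b \<Rightarrow> 'a::comm_monoid_add"
  assumes "finite I" "l \<in> I" "m \<in> I" "l \<noteq> m" "\<And>n. n \<in> I \<Longrightarrow> n \<noteq> l \<Longrightarrow> n \<noteq> m \<Longrightarrow> g n = 0"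
  shows "sum g I = g l + g m"
proof -
  have "sum g I = sum g {l, m}"
    using assms by (intro sum.mono_neutral_right) auto
  then show ?thesis using assms(4) by simp
qed

lemma sum_eq_one:
  fixes g :: "'b \<Rightarrow> 'a::comm_monoid_add"
  assumes "finite I" "l \<in> I" "\<And>n. n \<in> I \<Longrightarrow> n \<noteq> l \<Longrightarrow> g n = 0"
  shows "sum g I = g l"
proof -
  have "sum g I = sum g {l}"
    using assms by (intro sum.mono_neutral_right) auto
  then show ?thesis by simp
qed

definition dot :: "'k set \<Rightarrow> ('k \<Rightarrow> real) \<Rightarrow> ('k \<Rightarrow> real) \<Rightarrow> real" where
  "dot K a b = (\<Sum>k\<in>K. a k * b k)"

lemma dot_commute: "dot K a b = dot K b a"
  by (simp add: dot_def mult.commute)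

lemma dot_cong: "(\<And>k. k \<in> K \<Longrightarrow> a k = a' k) \<Longrightarrow> (\<And>k. k \<in> K \<Longrightarrow> b k = b' k) \<Longrightarrow> dot K a b = dot K a' b'"
  by (simp add: dot_def)

lemma dot_sum_left: "dot K (\<lambda>k. \<Sum>m\<in>I. c m * v m k) b = (\<Sum>m\<in>I. c m * dot K (v m) b)"
proof -
  have "dot K (\<lambda>k. \<Sum>m\<in>I. c m * v m k) b = (\<Sum>k\<in>K. \<Sum>m\<in>I. c m * (v m k * b k))"
    by (simp add: dot_def sum_distrib_right mult.assoc)
  also have "\<dots> = (\<Sum>m\<in>I. \<Sum>k\<in>K. c m * (v m k * b k))" by (rule sum.swap)
  finally show ?thesis by (simp add: dot_def sum_distrib_left)
qed

lemma dot_sum_right: "dot K b (\<lambda>k. \<Sum>m\<in>I. c m * v m k) = (\<Sum>m\<in>I. c m * dot K b (v m))"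
  unfolding dot_commute[of K b] by (rule dot_sum_left)

lemma dot_add_self: "dot K (\<lambda>k. a k + b k) (\<lambda>k. a k + b k) = dot K a a + dot K b b + 2 * dot K a b"
  by (simp add: dot_def sum.distrib algebra_simps sum_distrib_left)

lemma dot_self_eq_0: "finite K \<Longrightarrow> dot K a a = 0 \<Longrightarrow> k \<in> K \<Longrightarrow> a k = 0"
  unfolding dot_def by (subst (asm) sum_nonneg_eq_0_iff) auto

text \<open>The difference e of the two coefficient vectors of v l s and w l s in the respective bases of unit
  steps vanishes at l, and the combination r of the w m 1 with weights e is orthogonal to w n 1 for all
  n other than l. So r is orthogonal to itself.\<close>

lemma additive_isometry_inner:
  fixes v w :: "nat \<Rightarrow> real \<Rightarrow> 'k \<Rightarrow> real"
  assumes fin: "finite I" "finite K"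
    and gram: "\<And>l m s t. l \<in> I \<Longrightarrow> m \<in> I \<Longrightarrow> l \<noteq> m \<Longrightarrow> dot K (v l s) (v m t) = dot K (w l s) (w m t)"
    and diag: "\<And>l. l \<in> I \<Longrightarrow> dot K (v l 1) (v l 1) = dot K (w l 1) (w l 1)"
    and v: "\<And>l s. l \<in> I \<Longrightarrow> \<exists>c. c l = s \<and> (\<forall>k\<in>K. v l s k = (\<Sum>m\<in>I. c m * v m 1 k))"
    and w: "\<And>l s. l \<in> I \<Longrightarrow> \<exists>c. c l = s \<and> (\<forall>k\<in>K. w l s k = (\<Sum>m\<in>I. c m * w m 1 k))"
    and indep: "\<And>c. (\<forall>k\<in>K. (\<Sum>m\<in>I. c m * w m 1 k) = 0) \<Longrightarrow> \<forall>m\<in>I. c m = 0"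
    and lm: "l \<in> I" "m \<in> I"
  shows "dot K (v l s) (v m t) = dot K (w l s) (w m t)"
proof -
  have unit: "dot K (v n 1) (v n' 1) = dot K (w n 1) (w n' 1)" if "n \<in> I" "n' \<in> I" for n n'
    using gram diag that by (cases "n = n'") auto
  have coeffs: "\<exists>c. (\<forall>k\<in>K. v l s k = (\<Sum>m\<in>I. c m * v m 1 k)) \<and> (\<forall>k\<in>K. w l s k = (\<Sum>m\<in>I. c m * w m 1 k))"
    if l: "l \<in> I" for l s
  proof -
    obtain c where c: "c l = s" "\<And>k. k \<in> K \<Longrightarrow> v l s k = (\<Sum>m\<in>I. c m * v m 1 k)"
      using v[OF l] by meson
    obtain d where d: "d l = s" "\<And>k. k \<in> K \<Longrightarrow> w l s k = (\<Sum>m\<in>I. d m * w m 1 k)"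
      using w[OF l] by meson
    define e where "e = (\<lambda>m. c m - d m)"
    define r where "r = (\<lambda>k. \<Sum>m\<in>I. e m * w m 1 k)"
    have orth: "dot K r (w n 1) = 0" if n: "n \<in> I" "n \<noteq> l" for n
    proof -
      have "dot K (v l s) (v n 1) = (\<Sum>m\<in>I. c m * dot K (v m 1) (v n 1))"
        unfolding dot_sum_left[symmetric] by (rule dot_cong) (simp_all add: c(2))
      also have "\<dots> = (\<Sum>m\<in>I. c m * dot K (w m 1) (w n 1))"
        using unit n by (intro sum.cong) auto
      finally have 1: "dot K (v l s) (v n 1) = (\<Sum>m\<in>I. c m * dot K (w m 1) (w n 1))" .
      have 2: "dot K (w l s) (w n 1) = (\<Sum>m\<in>I. d m * dot K (w m 1) (w n 1))"
        unfolding dot_sum_left[symmetric] by (rule dot_cong) (simp_all add: d(2))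
      have "dot K r (w n 1) = (\<Sum>m\<in>I. e m * dot K (w m 1) (w n 1))"
        unfolding r_def by (rule dot_sum_left)
      also have "\<dots> = 0"
        using 1 2 gram[OF l n(1), of s 1] n by (simp add: e_def left_diff_distrib sum_subtractf)
      finally show ?thesis .
    qed
    have "dot K r r = (\<Sum>n\<in>I. e n * dot K r (w n 1))"
      by (subst (2) r_def) (rule dot_sum_right)
    also have "\<dots> = 0"
    proof (rule sum.neutral, rule ballI)
      fix n assume "n \<in> I"
      then show "e n * dot K r (w n 1) = 0"
        using orth c(1) d(1) by (cases "n = l") (auto simp: e_def)
    qed
    finally have "\<forall>k\<in>K. r k = 0" using dot_self_eq_0[OF fin(2)] by blast
    \<comment> \<open>Thus \<open>v l s\<close> and \<open>w l s\<close> have the same coefficients,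
      and all inner products reduce to those of unit steps. This settles the case
      \<open>l = m\<close>, which \<open>gram\<close> leaves open.\<close>
    then have "\<forall>m\<in>I. e m = 0" unfolding r_def by (rule indep)
    then have "(\<Sum>m\<in>I. d m * w m 1 k) = (\<Sum>m\<in>I. c m * w m 1 k)" for k
      by (intro sum.cong) (auto simp: e_def)
    with c d show ?thesis by (intro exI[of _ c]) simp
  qed
  obtain c where c: "\<And>k. k \<in> K \<Longrightarrow> v l s k = (\<Sum>n\<in>I. c n * v n 1 k)"
    "\<And>k. k \<in> K \<Longrightarrow> w l s k = (\<Sum>n\<in>I. c n * w n 1 k)"
    using coeffs[OF lm(1)] by meson
  obtain d where d: "\<And>k. k \<in> K \<Longrightarrow> v m t k = (\<Sum>n\<in>I. d n * v n 1 k)"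
    "\<And>k. k \<in> K \<Longrightarrow> w m t k = (\<Sum>n\<in>I. d n * w n 1 k)"
    using coeffs[OF lm(2)] by meson
  have "dot K (v l s) (v m t) = (\<Sum>n\<in>I. c n * (\<Sum>n'\<in>I. d n' * dot K (v n 1) (v n' 1)))"
    unfolding dot_sum_left[symmetric] dot_sum_right[symmetric] using c d by (intro dot_cong) auto
  also have "\<dots> = (\<Sum>n\<in>I. c n * (\<Sum>n'\<in>I. d n' * dot K (w n 1) (w n' 1)))"
    using unit by (intro sum.cong arg_cong[where f="\<lambda>x. c _ * x"]) auto
  also have "\<dots> = dot K (w l s) (w m t)"
    unfolding dot_sum_left[symmetric] dot_sum_right[symmetric] using c d by (intro dot_cong) auto
  finally show ?thesis .
qed

section \<open>Polarization of the quadratic form for nonlinear noise maps\<close>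

text \<open>The increment of the noise at \<open>k\<close> when coordinate \<open>l\<close> of the
  base point \<open>x\<close> is moved by \<open>s\<close>. Of \<open>x\<close> it reads coordinate
  \<open>l\<close> only.\<close>

definition noise_step ::
  "(nat \<times> nat) set \<Rightarrow> (nat \<Rightarrow> nat \<Rightarrow> real \<Rightarrow> real) \<Rightarrow> (nat \<Rightarrow> real) \<Rightarrow> nat \<Rightarrow> real \<Rightarrow> nat \<Rightarrow> real"
  where "noise_step D f x l s k =
    (if k = l then s else 0) - (if l \<in> pa D k then f k l (x l + s) - f k l (x l) else 0)"

lemma noise_step_0 [simp]: "noise_step D f x l 0 k = 0"
  by (simp add: noise_step_def)

lemma sum_pa: "D \<subseteq> I \<times> I \<Longrightarrow> finite I \<Longrightarrow> (\<Sum>l\<in>I. if l \<in> pa D k then g l else 0) = (\<Sum>l\<in>pa D k. g l)"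
  for g :: "nat \<Rightarrow> real"
proof -
  assume "D \<subseteq> I \<times> I" "finite I"
  then have "{l \<in> I. l \<in> pa D k} = pa D k" by (auto simp: pa_def)
  with \<open>finite I\<close> show ?thesis by (simp add: sum.inter_filter[symmetric])
qed

text \<open>Each edge function reads a single coordinate, so moving several coordinates produces no
  cross terms.\<close>

lemma noise_add_eq_sum_noise_step:
  assumes "D \<subseteq> I \<times> I" "finite I" "k \<in> I"
  shows "noise D \<mu> f (\<lambda>l. x l + y l) k = noise D \<mu> f x k + (\<Sum>l\<in>I. noise_step D f x l (y l) k)"
proof -
  have "(\<Sum>l\<in>I. noise_step D f x l (y l) k) =
      y k - (\<Sum>l\<in>pa D k. f k l (x l + y l) - f k l (x l))"
    using assms by (simp add: noise_step_def sum_subtractf sum_pa)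
  then show ?thesis by (simp add: noise_def sum_subtractf)
qed

text \<open>As a function of the coefficients, a combination of unit steps is itself a noise map
  with linear edge functions. Existence and uniqueness of coefficients thus follow from
  \<open>noise_surj\<close> and \<open>noise_eq_imp_eq\<close>.\<close>

lemma sum_noise_step_unit:
  assumes "D \<subseteq> I \<times> I" "finite I" "k \<in> I"
  shows "(\<Sum>m\<in>I. c m * noise_step D f x m 1 k) =
    noise D (\<lambda>_. 0) (\<lambda>k m t. t * (f k m (x m + 1) - f k m (x m))) c k"
proof -
  have "(\<Sum>m\<in>I. c m * noise_step D f x m 1 k) =
      (\<Sum>m\<in>I. (if k = m then c m else 0) - (if m \<in> pa D k then c m * (f k m (x m + 1) - f k m (x m)) else 0))"
    by (intro sum.cong) (auto simp: noise_step_def algebra_simps)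
  also have "\<dots> = c k - (\<Sum>m\<in>pa D k. c m * (f k m (x m + 1) - f k m (x m)))"
    using assms by (simp add: sum_subtractf sum_pa)
  finally show ?thesis by (simp add: noise_def)
qed

lemma wf_no_cycle: "wf D \<Longrightarrow> (a, b) \<in> D\<^sup>* \<Longrightarrow> (b, a) \<notin> D"
  by (meson rtrancl_into_trancl1 wf_acyclic acyclic_def)

text \<open>The coefficients solve a triangular system. At \<open>l\<close> and its ancestors the
  right-hand side is \<open>s\<close> at \<open>l\<close> and zero elsewhere, because
  \<open>l\<close> is not a parent of any of them; this gives \<open>c l = s\<close>.\<close>

lemma noise_step_unit_coeffs:
  assumes D: "D \<subseteq> I \<times> I" "finite I" "wf D"
  shows "\<exists>c. c l = s \<and> (\<forall>k\<in>I. noise_step D f x l s k = (\<Sum>m\<in>I. c m * noise_step D f x m 1 k))"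
proof -
  let ?N = "noise D (\<lambda>_. 0) (\<lambda>k m t. t * (f k m (x m + 1) - f k m (x m)))"
  obtain c where c: "\<And>k. ?N c k = noise_step D f x l s k"
    using noise_surj[OF D(3), of _ _ "noise_step D f x l s"] by blast
  have "c l = (if l = l then s else 0)"
  proof (rule noise_eq_imp_eq[where x=c and k=l and y="\<lambda>m. if m = l then s else 0", OF D(3)])
    fix a assume "(a, l) \<in> D\<^sup>*"
    then have a: "l \<notin> pa D a" using wf_no_cycle[OF D(3)] by (auto simp: pa_def)
    then have "(\<Sum>m\<in>pa D a. (if m = l then s else 0) * (f a m (x m + 1) - f a m (x m))) = 0"
      by (intro sum.neutral) auto
    then have "?N (\<lambda>m. if m = l then s else 0) a = (if a = l then s else 0)"
      by (simp add: noise_def)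
    then show "?N c a = ?N (\<lambda>m. if m = l then s else 0) a"
      using a by (simp add: c noise_step_def)
  qed
  then show ?thesis
    using c D by (intro exI[of _ c]) (simp add: sum_noise_step_unit)
qed

text \<open>Uniqueness in the same triangular system, by comparison with the zero vector.\<close>

lemma noise_step_unit_independent:
  assumes D: "D \<subseteq> I \<times> I" "finite I" "wf D"
    and zero: "\<forall>k\<in>I. (\<Sum>m\<in>I. c m * noise_step D f x m 1 k) = 0"
  shows "\<forall>m\<in>I. c m = 0"
proof
  fix m assume m: "m \<in> I"
  show "c m = 0"
  proof (rule noise_eq_imp_eq[where x=c and k=m and y="\<lambda>_. 0", OF D(3)])
    fix a assume "(a, m) \<in> D\<^sup>*"
    then have "a \<in> I" using D m by (auto elim: converse_rtranclE)
    then show "noise D (\<lambda>_. 0) (\<lambda>k m t. t * (f k m (x m + 1) - f k m (x m))) c a =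
        noise D (\<lambda>_. 0) (\<lambda>k m t. t * (f k m (x m + 1) - f k m (x m))) (\<lambda>_. 0) a"
      using zero D by (simp add: sum_noise_step_unit) (simp add: noise_def)
  qed
qed

lemma sqrt_scaled_mult: "s > 0 \<Longrightarrow> sqrt s * a * (sqrt s * b) / s = a * b"
  using real_sqrt_mult_self[of s] by (simp add: algebra_simps)

text \<open>The noise maps are not linear, so the usual polarization identity does not apply to
  arbitrary points. Around a common zero both are sums of one-coordinate steps. Moving two
  coordinates gives the mixed inner products, \<open>additive_isometry_inner\<close> those within
  one coordinate, and bilinearity the rest.\<close>

lemma noise_polarization:
  assumes fin: "finite I"
    and D: "D \<subseteq> I \<times> I" "wf D" and s2: "\<And>k. k \<in> I \<Longrightarrow> s2 k > 0"
    and D': "D' \<subseteq> I \<times> I" "wf D'" and s2': "\<And>k. k \<in> I \<Longrightarrow> s2' k > 0"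
    and quad: "\<And>x. (\<Sum>k\<in>I. (noise D \<mu> f x k)\<^sup>2 / s2 k) = (\<Sum>k\<in>I. (noise D' \<mu>' f' x k)\<^sup>2 / s2' k)"
  shows "(\<Sum>k\<in>I. noise D \<mu> f x k * noise D \<mu> f y k / s2 k) =
    (\<Sum>k\<in>I. noise D' \<mu>' f' x k * noise D' \<mu>' f' y k / s2' k)"
proof -
  obtain x0 where x0: "\<And>k. noise D \<mu> f x0 k = 0"
    using noise_surj[OF D(2), of _ _ "\<lambda>_. 0"] by blast
  \<comment> \<open>Equality of the quadratic forms makes the zero of the first noise map a zero of
    the second on \<open>I\<close>.\<close>
  have "(\<Sum>k\<in>I. (noise D' \<mu>' f' x0 k)\<^sup>2 / s2' k) = 0"
    unfolding quad[symmetric] by (simp add: x0)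
  then have "\<forall>k\<in>I. (noise D' \<mu>' f' x0 k)\<^sup>2 / s2' k = 0"
    using fin s2' by (subst (asm) sum_nonneg_eq_0_iff) (auto simp: less_imp_le)
  then have x0': "noise D' \<mu>' f' x0 k = 0" if "k \<in> I" for k
    using s2' that by force
  \<comment> \<open>The standardisation takes place here: steps are divided by the standard
    deviations, so that both quadratic forms become plain sums of squares.\<close>
  define v where "v = (\<lambda>l s k. 1 / sqrt (s2 k) * noise_step D f x0 l s k)"
  define w where "w = (\<lambda>l s k. 1 / sqrt (s2' k) * noise_step D' f' x0 l s k)"
  define F where "F = (\<lambda>u k. \<Sum>l\<in>I. v l (u l) k)"
  define F' where "F' = (\<lambda>u k. \<Sum>l\<in>I. w l (u l) k)"
  have F: "noise D \<mu> f (\<lambda>l. x0 l + u l) k = sqrt (s2 k) * F u k" if "k \<in> I" for u k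
    using noise_add_eq_sum_noise_step[OF D(1) fin that, of \<mu> f x0 u] s2[OF that]
    by (simp add: x0 F_def v_def sum_distrib_left)
  have F': "noise D' \<mu>' f' (\<lambda>l. x0 l + u l) k = sqrt (s2' k) * F' u k" if "k \<in> I" for u k
    using noise_add_eq_sum_noise_step[OF D'(1) fin that, of \<mu>' f' x0 u] s2'[OF that]
    by (simp add: x0'[OF that] F'_def w_def sum_distrib_left)
  have bil: "(\<Sum>k\<in>I. noise D \<mu> f (\<lambda>l. x0 l + u l) k * noise D \<mu> f (\<lambda>l. x0 l + u' l) k / s2 k) = dot I (F u) (F u')"
    for u u' unfolding dot_def
  proof (rule sum.cong)
    fix k assume k: "k \<in> I"
    then show "noise D \<mu> f (\<lambda>l. x0 l + u l) k * noise D \<mu> f (\<lambda>l. x0 l + u' l) k / s2 k = F u k * F u' k"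
      by (simp only: F sqrt_scaled_mult[OF s2[OF k]])
  qed simp
  have bil': "(\<Sum>k\<in>I. noise D' \<mu>' f' (\<lambda>l. x0 l + u l) k * noise D' \<mu>' f' (\<lambda>l. x0 l + u' l) k / s2' k) = dot I (F' u) (F' u')"
    for u u' unfolding dot_def
  proof (rule sum.cong)
    fix k assume k: "k \<in> I"
    then show "noise D' \<mu>' f' (\<lambda>l. x0 l + u l) k * noise D' \<mu>' f' (\<lambda>l. x0 l + u' l) k / s2' k = F' u k * F' u' k"
      by (simp only: F' sqrt_scaled_mult[OF s2'[OF k]])
  qed simp
  have iso: "dot I (F u) (F u) = dot I (F' u) (F' u)" for u
    using quad[of "\<lambda>l. x0 l + u l"] bil[of u u] bil'[of u u] by (simp add: power2_eq_square)
  have v0: "v l 0 k = 0" "w l 0 k = 0" for l k by (simp_all add: v_def w_def)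
  have norm_eq: "dot I (v l s) (v l s) = dot I (w l s) (w l s)" if "l \<in> I" for l s
  proof -
    let ?u = "\<lambda>n. if n = l then s else 0"
    have "F ?u k = v l s k" "F' ?u k = w l s k" for k
      unfolding F_def F'_def
      by (subst sum_eq_one[OF fin that], simp_all add: v0)+
    then show ?thesis using iso[of ?u] by (simp cong: dot_cong)
  qed
  have gram: "dot I (v l s) (v m t) = dot I (w l s) (w m t)" if "l \<in> I" "m \<in> I" "l \<noteq> m" for l m s t
  proof -
    \<comment> \<open>With two coordinates moved, the norms of the single steps cancel by
      \<open>norm_eq\<close> and twice the inner product remains.\<close>
    let ?u = "\<lambda>n. if n = l then s else if n = m then t else 0"
    have "F ?u k = v l s k + v m t k" "F' ?u k = w l s k + w m t k" for k
      unfolding F_def F'_def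
      using that by (subst sum_eq_two[OF fin that], simp_all add: v0)+
    then have "F ?u = (\<lambda>k. v l s k + v m t k)" "F' ?u = (\<lambda>k. w l s k + w m t k)"
      by auto
    then show ?thesis using iso[of ?u] norm_eq[of l s] norm_eq[of m t] that by (simp add: dot_add_self)
  qed
  have vc: "\<exists>c. c l = s \<and> (\<forall>k\<in>I. v l s k = (\<Sum>m\<in>I. c m * v m 1 k))" for l s
  proof -
    obtain c where "c l = s" "\<forall>k\<in>I. noise_step D f x0 l s k = (\<Sum>m\<in>I. c m * noise_step D f x0 m 1 k)"
      using noise_step_unit_coeffs[OF D(1) fin D(2)] by blast
    then show ?thesis
      by (intro exI[of _ c]) (simp add: v_def sum_divide_distrib)
  qed
  have wc: "\<exists>c. c l = s \<and> (\<forall>k\<in>I. w l s k = (\<Sum>m\<in>I. c m * w m 1 k))" for l s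
  proof -
    obtain c where "c l = s" "\<forall>k\<in>I. noise_step D' f' x0 l s k = (\<Sum>m\<in>I. c m * noise_step D' f' x0 m 1 k)"
      using noise_step_unit_coeffs[OF D'(1) fin D'(2)] by blast
    then show ?thesis
      by (intro exI[of _ c]) (simp add: w_def sum_divide_distrib)
  qed
  have indep: "\<forall>m\<in>I. c m = 0" if "\<forall>k\<in>I. (\<Sum>m\<in>I. c m * w m 1 k) = 0" for c
  proof (rule noise_step_unit_independent[OF D'(1) fin D'(2)])
    show "\<forall>k\<in>I. (\<Sum>m\<in>I. c m * noise_step D' f' x0 m 1 k) = 0"
    proof
      fix k assume k: "k \<in> I"
      have "(\<Sum>m\<in>I. c m * noise_step D' f' x0 m 1 k) / sqrt (s2' k) = (\<Sum>m\<in>I. c m * w m 1 k)"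
        by (simp add: w_def sum_divide_distrib)
      then show "(\<Sum>m\<in>I. c m * noise_step D' f' x0 m 1 k) = 0"
        using that k s2'[OF k] by simp
    qed
  qed
  have inner: "dot I (v l s) (v m t) = dot I (w l s) (w m t)" if "l \<in> I" "m \<in> I" for l m s t
    by (rule additive_isometry_inner[OF fin fin gram norm_eq vc wc indep that])
  have "dot I (F u) (F u') = dot I (F' u) (F' u')" for u u'
    unfolding F_def F'_def
    by (simp add: dot_sum_left[where c="\<lambda>_. 1", simplified] dot_sum_right[where c="\<lambda>_. 1", simplified] inner)
  from this[of "\<lambda>l. x l - x0 l" "\<lambda>l. y l - x0 l"] show ?thesis
    unfolding bil[symmetric] bil'[symmetric] by simp
qed

section \<open>Second derivatives along one coordinate and the descendant claim\<close>

text \<open>Turns a relation between edge functions into one between their second derivatives, the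
  form in which linear independence is assumed.\<close>

lemma deriv2_lincomb_affine_eq_0:
  assumes C2: "\<And>l. l \<in> S \<Longrightarrow> C2 (g l)"
    and affine: "\<And>t. (\<Sum>l\<in>S. c l * g l t) = a + b * t"
  shows "(\<Sum>l\<in>S. c l * deriv (deriv (g l)) t) = 0"
proof -
  have d: "(g l has_field_derivative deriv (g l) t) (at t)"
    "(deriv (g l) has_field_derivative deriv (deriv (g l)) t) (at t)" if "l \<in> S" for l t
    using C2[OF that] by (auto simp: C2_def intro!: DERIV_deriv_iff_real_differentiable[THEN iffD2])
  have "((\<lambda>t. \<Sum>l\<in>S. c l * g l t) has_field_derivative (\<Sum>l\<in>S. c l * deriv (g l) t)) (at t)" for t
    by (intro DERIV_sum DERIV_cmult d)
  moreover have "((\<lambda>t. \<Sum>l\<in>S. c l * g l t) has_field_derivative b) (at t)" for t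
    unfolding affine by (auto intro!: derivative_eq_intros)
  ultimately have "(\<Sum>l\<in>S. c l * deriv (g l) t) = b" for t
    by (rule DERIV_unique)
  then have "((\<lambda>t. \<Sum>l\<in>S. c l * deriv (g l) t) has_field_derivative 0) (at t)"
    by simp
  moreover have "((\<lambda>t. \<Sum>l\<in>S. c l * deriv (g l) t) has_field_derivative
      (\<Sum>l\<in>S. c l * deriv (deriv (g l)) t)) (at t)"
    by (intro DERIV_sum DERIV_cmult d)
  ultimately show ?thesis by (blast intro: DERIV_unique)
qed

lemma noise_fun_upd:
  assumes "finite (pa D k)"
  shows "noise D \<mu> f (x(i := t)) k =
    noise D \<mu> f x k + (if k = i then t - x i else 0) - (if k \<in> ch D i then f k i t - f k i (x i) else 0)"
proof -
  have "(\<Sum>l\<in>pa D k. f k l ((x(i := t)) l)) =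
      (\<Sum>l\<in>pa D k. f k l (x l) + (if l = i then f k i t - f k i (x i) else 0))"
    by (intro sum.cong) auto
  also have "\<dots> = (\<Sum>l\<in>pa D k. f k l (x l)) + (if k \<in> ch D i then f k i t - f k i (x i) else 0)"
    using assms by (simp add: sum.distrib pa_def ch_def)
  finally show ?thesis by (simp add: noise_def)
qed

theorem mainTheorem5:
  fixes p :: nat and P :: "(nat \<Rightarrow> real) measure" and D :: "(nat \<times> nat) set"
    and \<mu> :: "nat \<Rightarrow> real" and f :: "nat \<Rightarrow> nat \<Rightarrow> real \<Rightarrow> real" and s2 :: "nat \<Rightarrow> real"
    and i j :: nat
  assumes gen: "generated_by p P D \<mu> f s2"
    and child: "j \<in> ch D i"
    and nonlin: "nonlinear (f j i)"
    and linindep: "\<forall>c :: nat \<Rightarrow> real.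
        (\<forall>x. (\<Sum>j'\<in>{j' \<in> ch D i. nonlinear (f j' i)}. c j' * deriv (deriv (f j' i)) x) = 0)
        \<longrightarrow> (\<forall>j'\<in>{j' \<in> ch D i. nonlinear (f j' i)}. c j' = 0)"
  shows "\<forall>D' \<mu>' f' s2'. generated_by p P D' \<mu>' f' s2' \<longrightarrow> (i, j) \<in> D'\<^sup>*"
proof (intro allI impI, rule ccontr)
  fix D' \<mu>' f' s2'
  assume gen': "generated_by p P D' \<mu>' f' s2'" and not_desc: "(i, j) \<notin> D'\<^sup>*"
  let ?I = "{1..p}"
  let ?N = "noise D \<mu> f" and ?N' = "noise D' \<mu>' f'"
  have str: "plsem_struct p D f" and s2: "\<And>k. k \<in> ?I \<Longrightarrow> s2 k > 0"
    using gen by (auto simp: generated_by_def)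
  have str': "plsem_struct p D' f'" and s2': "\<And>k. k \<in> ?I \<Longrightarrow> s2' k > 0"
    using gen' by (auto simp: generated_by_def)
  have D: "D \<subseteq> ?I \<times> ?I" "wf D" and D': "D' \<subseteq> ?I \<times> ?I" "wf D'"
    using str str' plsem_struct_wf by (auto simp: plsem_struct_def)
  have j: "j \<in> ?I" and i: "i \<in> ?I" and p: "1 \<le> p"
    using child D(1) by (auto simp: ch_def)
  have fin_pa: "finite (pa D k)" "finite (pa D' k)" for k
    using D(1) D'(1) by (auto simp: pa_def intro!: finite_subset[OF _ finite_atLeastAtMost[of 1 p]])
  note quad = generated_by_quadratic_form_unique[OF gen gen' p]
  have polar: "(\<Sum>k\<in>?I. ?N x k * ?N y k / s2 k) = (\<Sum>k\<in>?I. ?N' x k * ?N' y k / s2' k)" for x y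
    by (rule noise_polarization[OF _ D s2 D' s2' quad]) simp_all
  \<comment> \<open>The noise of \<open>x0\<close> and \<open>y\<close> in \<open>D\<close> differs
    by one unit at \<open>j\<close> only. The contradiction comes from comparing these two points
    through \<open>D'\<close>.\<close>
  obtain x0 where x0: "\<And>k. ?N x0 k = 0"
    using noise_surj[OF D(2), of \<mu> f "\<lambda>_. 0"] by blast
  obtain y where y: "\<And>k. ?N y k = (if k = j then 1 else 0)"
    using noise_surj[OF D(2), of \<mu> f "\<lambda>k. if k = j then 1 else 0"] by blast
  have sum_unit: "(\<Sum>k\<in>?I. g k * (if k = a then 1 else 0) / s k) = g a / s a"
    if "a \<in> ?I" for a and g s :: "nat \<Rightarrow> real"
    by (subst sum_eq_one[OF _ that]) auto
  have zero: "?N' y k = 0" "?N' x0 k = 0" if k: "k \<in> ?I" "k \<notin> ch D' i" for k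
  proof -
    \<comment> \<open>Pairing with a point whose noise in \<open>D'\<close> is the
      \<open>k\<close>-th unit vector isolates row \<open>k\<close> of the orthogonal matrix. Up to
      positive factors from the standard deviations, the weights \<open>c\<close> below are the
      entries of that row.\<close>
    obtain z where z: "\<And>l. ?N' z l = (if l = k then 1 else 0)"
      using noise_surj[OF D'(2), of \<mu>' f' "\<lambda>l. if l = k then 1 else 0"] by blast
    have N': "?N' x k / s2' k = (\<Sum>l\<in>?I. ?N x l * ?N z l / s2 l)" for x
      unfolding polar z by (simp only: sum_unit[OF k(1)])
    define c where "c = (\<lambda>l. ?N z l / s2 l)"
    define x :: "nat \<Rightarrow> real" where "x = (\<lambda>_. 0)"
    \<comment> \<open>Only coordinate \<open>i\<close> varies, starting from the zero vector. Since
      \<open>k\<close> is not a child of \<open>i\<close> in \<open>D'\<close>, its noise there is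
      affine in \<open>t\<close>, with a slope only if \<open>k = i\<close>. Hence the combination
      of edge functions out of \<open>i\<close> in \<open>D\<close> is affine too.\<close>
    have "(\<Sum>l\<in>ch D i. c l * f l i t) = (\<Sum>l\<in>ch D i. c l * f l i 0) + (\<Sum>l\<in>?I. c l * ?N x l)
        - ?N' x k / s2' k + (c i - (if k = i then 1 / s2' k else 0)) * t" for t
    proof -
      have "(\<Sum>l\<in>?I. c l * ?N (x(i := t)) l) = (\<Sum>l\<in>?I. c l * ?N x l + (if l = i then c i * t else 0)
          - (if l \<in> ch D i then c l * f l i t - c l * f l i 0 else 0))"
        by (intro sum.cong refl) (simp add: noise_fun_upd[OF fin_pa(1)] x_def algebra_simps)
      also have "\<dots> = (\<Sum>l\<in>?I. c l * ?N x l) + c i * t - (\<Sum>l\<in>?I. if l \<in> ch D i then c l * f l i t - c l * f l i 0 else 0)"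
        using i by (simp add: sum.distrib sum_subtractf)
      also have "(\<Sum>l\<in>?I. if l \<in> ch D i then c l * f l i t - c l * f l i 0 else 0) = (\<Sum>l\<in>ch D i. c l * f l i t - c l * f l i 0)"
      proof -
        have "{l \<in> ?I. l \<in> ch D i} = ch D i" using D(1) by (auto simp: ch_def)
        then show ?thesis by (simp only: sum.inter_filter[OF finite_atLeastAtMost, symmetric])
      qed
      finally have 1: "(\<Sum>l\<in>?I. c l * ?N (x(i := t)) l) = (\<Sum>l\<in>?I. c l * ?N x l) + c i * t
          - (\<Sum>l\<in>ch D i. c l * f l i t) + (\<Sum>l\<in>ch D i. c l * f l i 0)"
        by (simp add: sum_subtractf fun_upd_def)
      have 2: "?N' (x(i := t)) k / s2' k = (\<Sum>l\<in>?I. c l * ?N (x(i := t)) l)"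
        unfolding N' c_def by (simp add: mult.commute)
      have 3: "?N' (x(i := t)) k / s2' k = ?N' x k / s2' k + (if k = i then 1 / s2' k else 0) * t"
        using k(2) by (simp add: noise_fun_upd[OF fin_pa(2)] x_def add_divide_distrib)
      show ?thesis using 1 2 3 by (simp add: algebra_simps)
    qed
    moreover have "C2 (f l i)" if "l \<in> ch D i" for l
      using str that by (auto simp: plsem_struct_def ch_def)
    ultimately have "(\<Sum>l\<in>ch D i. c l * deriv (deriv (f l i)) t) = 0" for t
      by (rule deriv2_lincomb_affine_eq_0[rotated])
    \<comment> \<open>Children with a linear edge function contribute zero second
      derivatives.\<close>
    moreover have "(\<Sum>l\<in>ch D i. c l * deriv (deriv (f l i)) t) =
        (\<Sum>l\<in>{l \<in> ch D i. nonlinear (f l i)}. c l * deriv (deriv (f l i)) t)" for t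
      using D(1) by (intro sum.mono_neutral_right finite_subset[of "ch D i" ?I])
        (auto simp: ch_def nonlinear_def)
    ultimately have "c j = 0"
      using linindep child nonlin by auto
    then have "?N z j / s2 j = 0" by (simp add: c_def)
    \<comment> \<open>As the noise of \<open>y\<close> in \<open>D\<close> is the
      \<open>j\<close>-th unit vector, the sum picks out exactly the weight
      \<open>c j\<close>.\<close>
    moreover have "?N' y k / s2' k = (\<Sum>l\<in>?I. ?N z l * ?N y l / s2 l)"
      unfolding N' by (simp add: mult.commute)
    moreover have "\<dots> = ?N z j / s2 j"
      unfolding y by (rule sum_unit[OF j])
    ultimately have "?N' y k / s2' k = 0" by linarith
    then show "?N' y k = 0" using s2'[OF k(1)] by simp
    show "?N' x0 k = 0"
      using N'[of x0] s2'[OF k(1)] by (simp add: x0)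
  qed
  \<comment> \<open>An ancestor of \<open>j\<close> in \<open>D'\<close> that were a child of
    \<open>i\<close> would make \<open>j\<close> a descendant of \<open>i\<close>. So both points
    have zero noise at all ancestors of \<open>j\<close> in \<open>D'\<close>.\<close>
  have "y j = x0 j"
  proof (rule noise_eq_imp_eq[OF D'(2)])
    fix a assume a: "(a, j) \<in> D'\<^sup>*"
    then have "a \<in> ?I" by (rule converse_rtranclE) (use D'(1) j in auto)
    moreover have "a \<notin> ch D' i"
      using a not_desc by (auto simp: ch_def dest: converse_rtrancl_into_rtrancl)
    ultimately show "?N' y a = ?N' x0 a" by (simp add: zero)
  qed
  \<comment> \<open>In \<open>D\<close>, acyclicity keeps \<open>j\<close> out of the ancestors of
    its parents, and elsewhere the noise of the two points agrees. With \<open>y j = x0 j\<close>,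
    the noise at \<open>j\<close> would have to agree as well, although it is 1 and 0.\<close>
  moreover have "y l = x0 l" if l: "l \<in> pa D j" for l
  proof (rule noise_eq_imp_eq[OF D(2)])
    fix a assume "(a, l) \<in> D\<^sup>*"
    then have "a \<noteq> j" using l wf_no_cycle[OF D(2)] by (auto simp: pa_def)
    then show "?N y a = ?N x0 a" by (simp add: x0 y)
  qed
  ultimately have "?N y j = ?N x0 j" by (simp add: noise_def)
  then show False by (simp add: x0 y)
qed

end
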